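(* Let $\xi=(\xi_i)_{i\in\mathbb{Z}}$ be a stationary process taking its values in a finite alphabet $\mathbb{A}$. If $\xi$ admits a 3-dot-type self-joining, then either $\xi$ is a periodic process, or $\xi$ has entropy at least $\log 2$.
   Context: A process $\xi=(\xi_i)_{i\in\mathbb{Z}}$ with values in a finite alphabet $\mathbb{A}$ is stationary if its distribution $\mu$ on $\mathbb{A}^{\mathbb{Z}}$ is invariant under the coordinate shift $T:(x_i)_{i\in\mathbb{Z}}\mapsto(x_{i+1})_{i\in\mathbb{Z}}$. A 3-fold self-joining of $\xi$ is a probability distribution $\lambda$ on $\mathbb{A}^{\mathbb{Z}}\times\mathbb{A}^{\mathbb{Z}}\times\mathbb{A}^{\mathbb{Z}}$ whose three marginals on $\mathbb{A}^{\mathbb{Z}}$ are all equal to $\mu$ and which is invariant under the coordinate shift $T\times T\times T$. The three coordinate processes under $\lambda$ are denoted by $\xi,\xi',\xi''$. A 3-dot-type self-joining of $\xi$ is a 3-fold self-joining $\lambda$ of $\xi$ under which the three processes $\xi,\xi',\xi''$ are pairwise independent, and for which there exists a map $f:\mathbb{A}\times\mathbb{A}\to\mathbb{A}$ such that, for all $i\in\mathbb{Z}$, $\xi''_i=f(\xi_i,\xi'_i)$ $\lambda$-almost surely. The process $\xi$ is periodic if there is an integer $n\ge1$ such that almost surely $\xi_{i+n}=\xi_i$ for all $i\in\mathbb{Z}$. The entropy of $\xi$ is $\lim_{m\to\infty}\frac1m H(\xi_0,\ldots,\xi_{m-1})$, where $H(X)=-\sum_x \mathbb{P}(X=x)\log\mathbb{P}(X=x)$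 is Shannon entropy, with the same logarithm as in $\log 2$. *)

theory Defs
  imports "HOL-Probability.Probability"
begin

text \<open>
  The finite alphabet is a type of class \<^class>\<open>finite\<close>; the space of two-sided sequences over it
  carries the product \<open>\<sigma>\<close>-algebra of the discrete one.
\<close>

definition seq_space :: "(int \<Rightarrow> 'a) measure" where
  "seq_space = (\<Pi>\<^sub>M i\<in>(UNIV :: int set). count_space UNIV)"

definition shift :: "(int \<Rightarrow> 'a) \<Rightarrow> (int \<Rightarrow> 'a)" where
  "shift x = (\<lambda>i. x (i + 1))"

definition process :: "'w measure \<Rightarrow> (int \<Rightarrow> 'w \<Rightarrow> 'a) \<Rightarrow> bool" where
  "process M \<xi> \<longleftrightarrow> prob_space M \<and> (\<forall>i. \<xi> i \<in> M \<rightarrow>\<^sub>M count_space UNIV)"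

definition law :: "'w measure \<Rightarrow> (int \<Rightarrow> 'w \<Rightarrow> 'a) \<Rightarrow> (int \<Rightarrow> 'a) measure" where
  "law M \<xi> = distr M seq_space (\<lambda>\<omega> i. \<xi> i \<omega>)"

definition stationary :: "'w measure \<Rightarrow> (int \<Rightarrow> 'w \<Rightarrow> 'a) \<Rightarrow> bool" where
  "stationary M \<xi> \<longleftrightarrow> distr (law M \<xi>) seq_space shift = law M \<xi>"

definition periodic :: "'w measure \<Rightarrow> (int \<Rightarrow> 'w \<Rightarrow> 'a) \<Rightarrow> bool" where
  "periodic M \<xi> \<longleftrightarrow> (\<exists>n::nat. n \<ge> 1 \<and> (AE \<omega> in M. \<forall>i. \<xi> (i + int n) \<omega> = \<xi> i \<omega>))"

text \<open>Triples of sequences are nested pairs \<open>(x, x', x'')\<close>.\<close>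

definition triple_space :: "((int \<Rightarrow> 'a) \<times> (int \<Rightarrow> 'a) \<times> (int \<Rightarrow> 'a)) measure" where
  "triple_space = seq_space \<Otimes>\<^sub>M (seq_space \<Otimes>\<^sub>M seq_space)"

definition self_joining3 ::
    "(int \<Rightarrow> 'a) measure \<Rightarrow> ((int \<Rightarrow> 'a) \<times> (int \<Rightarrow> 'a) \<times> (int \<Rightarrow> 'a)) measure \<Rightarrow> bool" where
  "self_joining3 \<mu> \<Lambda> \<longleftrightarrow>
     prob_space \<Lambda> \<and> sets \<Lambda> = sets triple_space \<and>
     distr \<Lambda> seq_space (\<lambda>(x, x', x''). x) = \<mu> \<and>
     distr \<Lambda> seq_space (\<lambda>(x, x', x''). x') = \<mu> \<and>
     distr \<Lambda> seq_space (\<lambda>(x, x', x''). x'') = \<mu> \<and>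
     distr \<Lambda> triple_space (\<lambda>(x, x', x''). (shift x, shift x', shift x'')) = \<Lambda>"

definition dot_type_self_joining3 ::
    "(int \<Rightarrow> 'a) measure \<Rightarrow> ((int \<Rightarrow> 'a) \<times> (int \<Rightarrow> 'a) \<times> (int \<Rightarrow> 'a)) measure \<Rightarrow> bool" where
  "dot_type_self_joining3 \<mu> \<Lambda> \<longleftrightarrow>
     self_joining3 \<mu> \<Lambda> \<and>
     prob_space.indep_var \<Lambda> seq_space (\<lambda>(x, x', x''). x) seq_space (\<lambda>(x, x', x''). x') \<and>
     prob_space.indep_var \<Lambda> seq_space (\<lambda>(x, x', x''). x) seq_space (\<lambda>(x, x', x''). x'') \<and>
     prob_space.indep_var \<Lambda> seq_space (\<lambda>(x, x', x''). x') seq_space (\<lambda>(x, x', x''). x'') \<and>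
     (\<exists>f :: 'a \<Rightarrow> 'a \<Rightarrow> 'a. \<forall>i. AE (x, x', x'') in \<Lambda>. x'' i = f (x i) (x' i))"

definition block :: "(int \<Rightarrow> 'w \<Rightarrow> 'a) \<Rightarrow> nat \<Rightarrow> 'w \<Rightarrow> 'a list" where
  "block \<xi> m = (\<lambda>\<omega>. map (\<lambda>k. \<xi> (int k) \<omega>) [0..<m])"

text \<open>
  The library entropy of a random variable relative to the counting measure on its (finite) range
  is its Shannon entropy in base \<open>b\<close>; see \<open>shannon_entropy_block\<close> below.
\<close>

definition shannon_entropy :: "real \<Rightarrow> 'w measure \<Rightarrow> ('w \<Rightarrow> 'c) \<Rightarrow> real" where
  "shannon_entropy b M X = prob_space.entropy M b (count_space (X ` space M)) X"

definition process_entropy :: "real \<Rightarrow> 'w measure \<Rightarrow> (int \<Rightarrow> 'w \<Rightarrow> 'a) \<Rightarrow> real" where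
  "process_entropy b M \<xi> = lim (\<lambda>m. shannon_entropy b M (block \<xi> m) / real m)"

lemma simple_function_block:
  fixes \<xi> :: "int \<Rightarrow> 'w \<Rightarrow> 'a::finite"
  assumes "process M \<xi>"
  shows "simple_function M (block \<xi> m)"
proof (induction m)
  case 0
  show ?case by (simp add: block_def)
next
  case (Suc m)
  have "\<xi> (int m) \<in> M \<rightarrow>\<^sub>M count_space UNIV"
    using assms by (auto simp: process_def)
  then have "simple_function M (\<xi> (int m))"
    by (auto simp: simple_function_def finite_subset[OF subset_UNIV] intro!: measurable_sets)
  then have "simple_function M (\<lambda>\<omega>. block \<xi> m \<omega> @ [\<xi> (int m) \<omega>])"
    by (rule simple_function_compose2[OF Suc, where h = "\<lambda>xs a. xs @ [a]"])
  then show ?case by (simp add: block_def)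
qed

lemma shannon_entropy_block:
  fixes \<xi> :: "int \<Rightarrow> 'w \<Rightarrow> 'a::finite"
  assumes "process M \<xi>" "b > 1"
  shows "shannon_entropy b M (block \<xi> m) =
           - (\<Sum>x\<in>block \<xi> m ` space M.
                measure M {\<omega> \<in> space M. block \<xi> m \<omega> = x} *
                log b (measure M {\<omega> \<in> space M. block \<xi> m \<omega> = x}))"
proof -
  interpret prob_space M using assms by (simp add: process_def)
  interpret information_space M b by unfold_locales fact
  have "simple_distributed M (block \<xi> m) (\<lambda>x. measure M {\<omega> \<in> space M. block \<xi> m \<omega> = x})"
    by (rule simple_distributedI[OF simple_function_block[OF assms(1)]])
      (auto intro!: arg_cong[where f = "measure M"])
  from entropy_simple_distributed[OF this] show ?thesis
    by (simp add: shannon_entropy_def)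
qed

end

theory Submission
  imports Defs "HOL-Combinatorics.Cycles"
begin

text \<open>
  Let \<open>X\<close>, \<open>Y\<close>, \<open>Z\<close> be identically distributed, finite-valued and pairwise independent, with
  \<open>Z = F X Y\<close>. Conditioning on \<open>Y = y\<close> shows that \<open>F _ y\<close> preserves the common distribution \<open>p\<close>; on a
  finite set such a map permutes the support, so \<open>p (F x y) = p x\<close>. By symmetry \<open>p (F x y) = p y\<close>,
  hence \<open>p\<close> is uniform on its support. In a dot-type self-joining this applies to the blocks of every
  length \<open>m\<close>. Let \<open>N m\<close> be the number of blocks of length \<open>m\<close> of positive probability. Uniformity
  forces all of them to have the same number \<open>N (m + 1) / N m\<close> of continuations by one letter, and
  this number is nonincreasing in \<open>m\<close>. If it is always at least 2, then the entropy, which is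
  the limit of \<open>ln (N m) / m\<close>, is at least \<open>ln 2\<close>. If it equals 1 for some \<open>m\<close>, then sliding a window of
  length \<open>m\<close> along the process is a permutation of a finite set, which has finite order.
\<close>

section \<open>Pairwise independent triples\<close>

text \<open>A point of positive weight has a preimage of positive weight, since otherwise its sum in
  \<open>pres\<close> vanishes. So \<open>g\<close> maps the finite support onto a superset of
  itself, hence bijectively onto itself, and the sum for \<open>g u\<close> has the single term
  \<open>p u\<close>.\<close>

lemma preserved_weight_on_support:
  fixes p :: "'c \<Rightarrow> real"
  assumes fin: "finite C" and nn: "\<And>c. 0 \<le> p c" and supp: "\<And>c. c \<notin> C \<Longrightarrow> p c = 0"
    and pres: "\<And>z. p z = (\<Sum>x | x \<in> C \<and> g x = z. p x)" and pos: "0 < p u"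
  shows "p (g u) = p u"
proof -
  define S where "S = {c \<in> C. 0 < p c}"
  have finS: "finite S" using fin by (simp add: S_def)
  have presS: "p z = (\<Sum>x | x \<in> S \<and> g x = z. p x)" for z
    unfolding pres[of z]
    by (rule sum.mono_neutral_right) (use fin nn in \<open>auto simp: S_def less_le\<close>)
  have "S \<subseteq> g ` S"
  proof
    fix z assume "z \<in> S"
    then have "{x. x \<in> S \<and> g x = z} \<noteq> {}"
      using presS[of z] by (metis (no_types, lifting) S_def less_irrefl mem_Collect_eq sum.empty)
    then show "z \<in> g ` S" by auto
  qed
  moreover have "card (g ` S) \<le> card S" by (rule card_image_le[OF finS])
  ultimately have "g ` S = S"
    using card_seteq[of "g ` S" S] finS by auto
  then have inj: "inj_on g S" by (simp add: finS eq_card_imp_inj_on)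
  have "u \<in> S" using pos supp[of u] by (auto simp: S_def)
  then have "{x. x \<in> S \<and> g x = g u} = {u}" using inj by (auto dest: inj_onD)
  then show ?thesis using presS[of "g u"] by simp
qed

text \<open>Up to a null set, the event \<open>Y = y\<close>, \<open>Z = z\<close> is the disjoint
  union of the events \<open>X = a\<close>, \<open>Y = y\<close> over all \<open>a\<close> with
  \<open>F a y = z\<close>. Both sides factor, and cancelling \<open>p y\<close> shows that
  \<open>F _ y\<close> preserves \<open>p\<close>.\<close>

lemma (in prob_space) conditional_map_preserves_weight:
  assumes meas: "random_variable (count_space UNIV) X" "random_variable (count_space UNIV) Y"
      "random_variable (count_space UNIV) Z"
    and fin: "finite C" "\<And>\<omega>. \<omega> \<in> space M \<Longrightarrow> X \<omega> \<in> C"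
    and XY: "\<And>x y. prob {\<omega> \<in> space M. X \<omega> = x \<and> Y \<omega> = y} = p x * p y"
    and YZ: "\<And>y z. prob {\<omega> \<in> space M. Y \<omega> = y \<and> Z \<omega> = z} = p y * p z"
    and X: "\<And>x. prob {\<omega> \<in> space M. X \<omega> = x} = p x"
    and F: "AE \<omega> in M. Z \<omega> = F (X \<omega>) (Y \<omega>)"
    and pos: "0 < p x" "0 < p y"
  shows "p (F x y) = p x"
proof (rule preserved_weight_on_support[where g = "\<lambda>x. F x y", OF fin(1)])
  have [measurable]: "Measurable.pred M (\<lambda>\<omega>. X \<omega> = a)" "Measurable.pred M (\<lambda>\<omega>. Y \<omega> = a)"
    "Measurable.pred M (\<lambda>\<omega>. Z \<omega> = a)" for a
    using meas by measurable
  show "0 \<le> p c" for c using X[of c] by (metis measure_nonneg)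
  show "p c = 0" if "c \<notin> C" for c
    using X[of c] fin(2) that by (metis (mono_tags, lifting) Collect_empty_eq measure_empty)
  show "0 < p x" by fact
  fix z
  have "p y * p z = prob {\<omega> \<in> space M. Y \<omega> = y \<and> Z \<omega> = z}" by (simp add: YZ)
  also have "\<dots> = prob (\<Union>a\<in>{a. a \<in> C \<and> F a y = z}. {\<omega> \<in> space M. X \<omega> = a \<and> Y \<omega> = y})"
  proof (rule measure_eq_AE)
    show "AE \<omega> in M. \<omega> \<in> {\<omega> \<in> space M. Y \<omega> = y \<and> Z \<omega> = z} \<longleftrightarrow>
        \<omega> \<in> (\<Union>a\<in>{a. a \<in> C \<and> F a y = z}. {\<omega> \<in> space M. X \<omega> = a \<and> Y \<omega> = y})"
      using F by eventually_elim (use fin(2) in auto)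
    show "(\<Union>a\<in>{a. a \<in> C \<and> F a y = z}. {\<omega> \<in> space M. X \<omega> = a \<and> Y \<omega> = y}) \<in> events"
      by (rule sets.finite_UN) (use fin(1) in auto)
  qed auto
  also have "\<dots> = (\<Sum>a | a \<in> C \<and> F a y = z. prob {\<omega> \<in> space M. X \<omega> = a \<and> Y \<omega> = y})"
    by (rule finite_measure_finite_Union) (use fin(1) in \<open>auto simp: disjoint_family_on_def\<close>)
  also have "\<dots> = p y * (\<Sum>a | a \<in> C \<and> F a y = z. p a)"
    by (simp add: XY sum_distrib_left mult.commute)
  finally show "p z = (\<Sum>a | a \<in> C \<and> F a y = z. p a)" using pos by simp
qed

lemma (in prob_space) indep_var_prob_eq:
  assumes "indep_var (count_space UNIV) X (count_space UNIV) Y"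
  shows "prob {\<omega> \<in> space M. X \<omega> = x \<and> Y \<omega> = y} =
    prob {\<omega> \<in> space M. X \<omega> = x} * prob {\<omega> \<in> space M. Y \<omega> = y}"
proof -
  have "(\<lambda>\<omega>. (X \<omega>, Y \<omega>)) -` ({x} \<times> {y}) \<inter> space M = {\<omega> \<in> space M. X \<omega> = x \<and> Y \<omega> = y}"
    "X -` {x} \<inter> space M = {\<omega> \<in> space M. X \<omega> = x}" "Y -` {y} \<inter> space M = {\<omega> \<in> space M. Y \<omega> = y}"
    by auto
  then show ?thesis using indep_varD[OF assms, of "{x}" "{y}"] by simp
qed

lemma (in prob_space) pairwise_indep_triple_uniform:
  assumes indep: "indep_var (count_space UNIV) X (count_space UNIV) Y"
      "indep_var (count_space UNIV) X (count_space UNIV) Z"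
      "indep_var (count_space UNIV) Y (count_space UNIV) Z"
    and fin: "finite C" "\<And>\<omega>. \<omega> \<in> space M \<Longrightarrow> X \<omega> \<in> C" "\<And>\<omega>. \<omega> \<in> space M \<Longrightarrow> Y \<omega> \<in> C"
    and law: "\<And>c. prob {\<omega> \<in> space M. X \<omega> = c} = p c" "\<And>c. prob {\<omega> \<in> space M. Y \<omega> = c} = p c"
      "\<And>c. prob {\<omega> \<in> space M. Z \<omega> = c} = p c"
    and F: "AE \<omega> in M. Z \<omega> = F (X \<omega>) (Y \<omega>)"
    and pos: "0 < p u" "0 < p v"
  shows "p u = p v"
proof -
  note rv = indep_var_rv1[OF indep(1)] indep_var_rv2[OF indep(1)] indep_var_rv2[OF indep(2)]
  note XY = indep_var_prob_eq[OF indep(1), unfolded law]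
  note XZ = indep_var_prob_eq[OF indep(2), unfolded law]
  note YZ = indep_var_prob_eq[OF indep(3), unfolded law]
  have YX: "prob {\<omega> \<in> space M. Y \<omega> = y \<and> X \<omega> = x} = p y * p x" for x y
    using XY[of x y] by (simp add: conj_commute mult.commute)
  have "p (F u v) = p u"
    by (rule conditional_map_preserves_weight[OF rv fin(1,2) XY YZ law(1) F pos])
  \<comment> \<open>The same argument with \<open>X\<close> and \<open>Y\<close> exchanged: now
    \<open>X = u\<close> is fixed and \<open>F u _\<close> acts on the values of
    \<open>Y\<close>.\<close>
  moreover have "p (F u v) = p v"
    by (rule conditional_map_preserves_weight[where F = "\<lambda>a b. F b a",
          OF rv(2,1,3) fin(1,3) YX XZ law(2) F pos(2,1)])
  ultimately show ?thesis by simp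
qed

section \<open>Windows\<close>

definition window :: "int \<Rightarrow> nat \<Rightarrow> (int \<Rightarrow> 'a) \<Rightarrow> 'a list" where
  "window i m x = map (\<lambda>k. x (i + int k)) [0..<m]"

lemma length_window [simp]: "length (window i m x) = m"
  by (simp add: window_def)

lemma window_0 [simp]: "window i 0 x = []"
  by (simp add: window_def)

lemma window_Suc: "window i (Suc m) x = window i m x @ [x (i + int m)]"
  by (simp add: window_def)

lemma window_Suc_Cons: "window i (Suc m) x = x i # window (i + 1) m x"
  by (induction m arbitrary: i) (simp_all add: window_Suc[of _ "Suc _"] window_Suc algebra_simps)

lemma window_shift: "window i m (shift x) = window (i + 1) m x"
  by (simp add: window_def shift_def algebra_simps)

text \<open>Because one \<open>f\<close> serves all coordinates, the letterwise relation lifts to a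
  function of words, which plays the role of \<open>F\<close> above.\<close>

lemma window_map2:
  assumes "\<And>i. z i = f (x i) (y i)"
  shows "window i m z = map2 f (window i m x) (window i m y)"
  by (rule nth_equalityI) (simp_all add: window_def assms)

lemma space_seq_space [simp]: "space seq_space = UNIV"
  by (auto simp: seq_space_def space_PiM)

lemma measurable_coordinate [measurable]: "(\<lambda>x. x i) \<in> seq_space \<rightarrow>\<^sub>M count_space UNIV"
  unfolding seq_space_def by (rule measurable_component_singleton) simp

lemma measurable_seqI:
  assumes "\<And>i. (\<lambda>\<omega>. f \<omega> i) \<in> N \<rightarrow>\<^sub>M count_space UNIV"
  shows "f \<in> N \<rightarrow>\<^sub>M seq_space"
  unfolding seq_space_def by (rule measurable_PiM_single') (use assms in auto)

lemma measurable_shift [measurable]: "shift \<in> seq_space \<rightarrow>\<^sub>M seq_space"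
  by (rule measurable_seqI) (simp add: shift_def measurable_coordinate)

lemma measurable_window [measurable]:
  "(window i m :: (int \<Rightarrow> 'a::finite) \<Rightarrow> 'a list) \<in> seq_space \<rightarrow>\<^sub>M count_space UNIV"
proof (induction m)
  case (Suc m)
  have "(\<lambda>x::int \<Rightarrow> 'a. window i m x @ [x (i + int m)]) \<in> seq_space \<rightarrow>\<^sub>M count_space UNIV"
    \<comment> \<open>There are only countably many words, so measurability can be checked with the
      prefix \<open>w\<close> held fixed.\<close>
    by (rule measurable_compose_countable[OF _ Suc, where f = "\<lambda>w x. w @ [x (i + int m)]"]) measurable
  then show ?case by (simp add: window_Suc[abs_def])
qed (simp add: window_def[abs_def])

section \<open>Shift-invariant laws\<close>

locale shift_invariant = prob_space \<mu> for \<mu> :: "(int \<Rightarrow> 'a::finite) measure" +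
  assumes sets_eq [measurable_cong]: "sets \<mu> = sets seq_space"
    and shift_law: "distr \<mu> seq_space shift = \<mu>"
begin

lemma space_eq [simp]: "space \<mu> = UNIV"
  using sets_eq_imp_space_eq[OF sets_eq] by simp

section \<open>Cylinder probabilities and the language of the process\<close>

definition weight :: "'a list \<Rightarrow> real" where
  "weight w = prob {x. window 0 (length w) x = w}"

definition lang :: "nat \<Rightarrow> 'a list set" where
  "lang m = {w. length w = m \<and> 0 < weight w}"

lemma weight_nonneg: "0 \<le> weight w"
  by (simp add: weight_def)

lemma length_lang: "w \<in> lang m \<Longrightarrow> length w = m"
  by (simp add: lang_def)

lemma finite_lang [simp]: "finite (lang m)"
  by (rule finite_subset[OF _ finite_lists_length_eq[of UNIV m]]) (auto simp: lang_def)

lemma events_window [measurable]: "{x. window i m x = w} \<in> events"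
proof -
  have "Measurable.pred \<mu> (\<lambda>x. window i m x = w)" by measurable
  then show ?thesis by (simp add: pred_def)
qed

lemma prob_window_step: "prob {x. window (i + 1) m x = w} = prob {x. window i m x = w}"
proof -
  have sh: "shift \<in> \<mu> \<rightarrow>\<^sub>M seq_space" by measurable
  have "prob {x. window i m x = w} = measure (distr \<mu> seq_space shift) {x. window i m x = w}"
    by (simp add: shift_law)
  also have "\<dots> = prob (shift -` {x. window i m x = w} \<inter> space \<mu>)"
    by (rule measure_distr[OF sh]) (use events_window sets_eq in auto)
  also have "shift -` {x. window i m x = w} \<inter> space \<mu> = {x. window (i + 1) m x = w}"
    by (auto simp: window_shift)
  finally show ?thesis ..
qed

lemma prob_window: "prob {x. window i (length w) x = w} = weight w"
proof (induction i rule: int_induct[of _ 0])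
  \<comment> \<open>The induction runs over the integers in both directions from 0; the downward
    case is invariance read from \<open>i - 1\<close> to \<open>i\<close>.\<close>
  case (step2 i)
  then show ?case using prob_window_step[of "i - 1" "length w" w] by simp
qed (simp_all add: weight_def prob_window_step)

lemma weight_snoc: "weight w = (\<Sum>a\<in>UNIV. weight (w @ [a]))"
proof -
  have "weight w = prob (\<Union>a. {x. window 0 (length (w @ [a])) x = w @ [a]})"
    unfolding weight_def by (rule arg_cong[where f = prob]) (auto simp: window_Suc)
  also have "\<dots> = (\<Sum>a\<in>UNIV. weight (w @ [a]))"
    unfolding weight_def
    by (rule finite_measure_finite_Union; (rule image_subsetI, rule events_window)?)
      (auto simp: disjoint_family_on_def)
  finally show ?thesis .
qed

text \<open>Stationarity allows \<open>w\<close> to be read at position 1; the event then splits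
  according to the letter at position 0.\<close>

lemma weight_Cons: "weight w = (\<Sum>a\<in>UNIV. weight (a # w))"
proof -
  have "weight w = prob {x. window 1 (length w) x = w}"
    by (simp add: prob_window)
  also have "\<dots> = prob (\<Union>a. {x. window 0 (length (a # w)) x = a # w})"
    by (rule arg_cong[where f = prob]) (auto simp: window_Suc_Cons)
  also have "\<dots> = (\<Sum>a\<in>UNIV. weight (a # w))"
    unfolding weight_def
    by (rule finite_measure_finite_Union; (rule image_subsetI, rule events_window)?)
      (auto simp: disjoint_family_on_def)
  finally show ?thesis .
qed

lemma sum_weight_lang: "(\<Sum>w\<in>lang m. weight w) = 1"
proof -
  let ?L = "{w :: 'a list. length w = m}"
  have fin: "finite ?L" using finite_lists_length_eq[of "UNIV :: 'a set" m] by simp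
  have "(\<Sum>w\<in>lang m. weight w) = (\<Sum>w\<in>?L. weight w)"
    by (rule sum.mono_neutral_left) (use fin weight_nonneg in \<open>auto simp: lang_def less_le\<close>)
  also have "\<dots> = (\<Sum>w\<in>?L. prob {x. window 0 m x = w})"
    by (rule sum.cong) (auto simp: weight_def)
  also have "\<dots> = prob (\<Union>w\<in>?L. {x. window 0 m x = w})"
    by (rule finite_measure_finite_Union[symmetric]) (use fin in \<open>auto simp: disjoint_family_on_def\<close>)
  also have "(\<Union>w\<in>?L. {x. window 0 m x = w}) = space \<mu>" by auto
  finally show ?thesis by (simp only: prob_space)
qed

text \<open>At each position the words of \<open>lang m\<close> carry total probability 1, and there
  are only countably many positions.\<close>

lemma AE_window_in_lang: "AE x in \<mu>. \<forall>i. window i m x \<in> lang m"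
proof (subst AE_all_countable, rule allI)
  fix i
  have "prob {x. window i m x \<in> lang m} = prob (\<Union>w\<in>lang m. {x. window i m x = w})"
    by (rule arg_cong[where f = prob]) auto
  also have "\<dots> = (\<Sum>w\<in>lang m. prob {x. window i m x = w})"
    by (rule finite_measure_finite_Union) (auto simp: disjoint_family_on_def)
  also have "\<dots> = (\<Sum>w\<in>lang m. weight w)"
    by (rule sum.cong[OF refl]) (metis length_lang prob_window)
  finally have "prob {x. window i m x \<in> lang m} = 1" by (simp add: sum_weight_lang)
  then show "AE x in \<mu>. window i m x \<in> lang m"
    using AE_prob_1[of "{x. window i m x \<in> lang m}"] by simp
qed

lemma lang_butlast: "w @ [a] \<in> lang (Suc m) \<Longrightarrow> w \<in> lang m"
  using member_le_sum[of a UNIV "\<lambda>a. weight (w @ [a])"] weight_nonneg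
  by (force simp: lang_def weight_snoc[of w])

lemma lang_tl: "a # w \<in> lang (Suc m) \<Longrightarrow> w \<in> lang m"
  using member_le_sum[of a UNIV "\<lambda>a. weight (a # w)"] weight_nonneg
  by (force simp: lang_def weight_Cons[of w])

lemma lang_Cons_ex:
  assumes "w \<in> lang m"
  obtains a where "a # w \<in> lang (Suc m)"
proof -
  have "(\<Sum>a\<in>UNIV. weight (a # w)) > 0" using assms by (simp add: lang_def weight_Cons[of w])
  then obtain a where "0 < weight (a # w)"
    by (metis (no_types, lifting) not_less sum_nonpos)
  then show ?thesis using that assms by (auto simp: lang_def)
qed

section \<open>Continuations of words and the periodic case\<close>

definition continuations :: "'a list \<Rightarrow> 'a set" where
  "continuations w = {a. 0 < weight (w @ [a])}"

text \<open>A longer past can only restrict the next letter: dropping the first letter of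
  \<open>a # w @ [b]\<close> keeps the weight positive.\<close>

lemma continuations_Cons_subset: "continuations (a # w) \<subseteq> continuations w"
proof
  fix b assume "b \<in> continuations (a # w)"
  then have "a # (w @ [b]) \<in> lang (Suc (Suc (length w)))" by (simp add: continuations_def lang_def)
  from lang_tl[OF this] show "b \<in> continuations w" by (simp add: continuations_def lang_def)
qed

lemma lang_nonempty: "lang m \<noteq> {}"
  using sum_weight_lang[of m] by auto

lemma continuation_iff: "w \<in> lang m \<Longrightarrow> a \<in> continuations w \<longleftrightarrow> w @ [a] \<in> lang (Suc m)"
  by (simp add: continuations_def lang_def)

text \<open>
  When every word of length \<open>m\<close> has a unique continuation, \<open>step\<close> below is the sliding of
  the window by one letter: it is onto because every word can also be extended to the left.
\<close>

lemma periodic_if_unique_continuations: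
  assumes unique: "\<And>w. w \<in> lang m \<Longrightarrow> card (continuations w) = 1"
  shows "\<exists>n::nat. n \<ge> 1 \<and> (AE x in \<mu>. \<forall>i. x (i + int n) = x i)"
proof -
  define next_letter where "next_letter w = the_elem (continuations w)" for w
  have next_letter: "a = next_letter w" if w: "w \<in> lang m" "w @ [a] \<in> lang (Suc m)" for w a
  proof -
    obtain c where "continuations w = {c}" using unique[OF w(1)] by (rule card_1_singletonE)
    then show ?thesis using continuation_iff[OF w(1), of a] w(2) by (simp add: next_letter_def)
  qed
  \<comment> \<open>The value \<open>w\<close> outside \<open>lang m\<close> is chosen because
    \<open>permutes\<close> requires fixing every point outside the set.\<close>
  define step where "step w = (if w \<in> lang m then tl (w @ [next_letter w]) else w)" for w
  have into: "step w \<in> lang m" if w: "w \<in> lang m" for w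
  proof -
    obtain a where "continuations w = {a}" using unique[OF w] by (rule card_1_singletonE)
    then have wa: "w @ [next_letter w] \<in> lang (Suc m)"
      using next_letter[OF w, of a] continuation_iff[OF w, of a] by simp
    then obtain b v where bv: "w @ [next_letter w] = b # v" by (cases "w @ [next_letter w]") auto
    then show ?thesis using wa lang_tl[of b v m] w by (simp add: step_def)
  qed
  have "lang m \<subseteq> step ` lang m"
  proof
    fix v assume "v \<in> lang m"
    then obtain b where b: "b # v \<in> lang (Suc m)" by (rule lang_Cons_ex)
    \<comment> \<open>Splitting off the last letter instead of the first exhibits the preimage
      \<open>w\<close> of \<open>v\<close>.\<close>
    obtain w a where wa: "b # v = w @ [a]" by (cases "b # v" rule: rev_cases) auto
    then have w: "w \<in> lang m" using b lang_butlast[of w a m] by simp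
    have "a = next_letter w" using next_letter[OF w] b wa by simp
    then have "step w = tl (w @ [a])" using w by (simp add: step_def)
    also have "\<dots> = v" by (simp flip: wa)
    finally have "step w = v" .
    then show "v \<in> step ` lang m" using w by blast
  qed
  then have "step ` lang m = lang m" using into by auto
  then have "bij_betw step (lang m) (lang m)"
    by (simp add: bij_betw_def eq_card_imp_inj_on)
  then have "step permutes lang m" by (rule bij_imp_permutes) (simp add: step_def)
  then have "permutation step" using permutation_permutes finite_lang by blast
  then obtain n where n: "step ^^ n = id" "n > 0" by (rule permutation_is_nilpotent)
  have "AE x in \<mu>. \<forall>i. x (i + int n) = x i"
    using AE_window_in_lang[of m] AE_window_in_lang[of "Suc m"]
  proof eventually_elim
    case (elim x)
    have next_eq: "x (i + int m) = next_letter (window i m x)" for i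
      using elim by (intro next_letter) (simp_all flip: window_Suc)
    have step_eq: "step (window i m x) = window (i + 1) m x" for i
    proof -
      have "step (window i m x) = tl (window i (Suc m) x)"
        using elim by (simp add: step_def window_Suc next_eq)
      then show ?thesis by (simp add: window_Suc_Cons)
    qed
    have iter: "(step ^^ k) (window i m x) = window (i + int k) m x" for i k
      by (induction k) (simp_all add: step_eq algebra_simps)
    have "window (i + int n) m x = window i m x" for i
      using iter[of n i] n(1) by simp
    \<comment> \<open>Equal windows have equal next letters. Comparing these, not letters inside the
      windows, also covers \<open>m = 0\<close>.\<close>
    then have "x (i + int n + int m) = x (i + int m)" for i
      by (simp only: next_eq)
    then have "x (i - int m + int n + int m) = x (i - int m + int m)" for i by blast
    then show ?case by (simp add: algebra_simps)
  qed
  then show ?thesis using n(2) by (intro exI[of _ n] conjI) simp_all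
qed

end

section \<open>Uniform laws and the growth of the language\<close>

locale uniform_shift_invariant = shift_invariant +
  assumes uniform: "\<lbrakk>v \<in> lang m; w \<in> lang m\<rbrakk> \<Longrightarrow> weight v = weight w"
begin

lemma weight_uniform:
  assumes "w \<in> lang m"
  shows "weight w = 1 / card (lang m)"
proof -
  have "card (lang m) * weight w = (\<Sum>v\<in>lang m. weight w)" by simp
  also have "\<dots> = (\<Sum>v\<in>lang m. weight v)" by (rule sum.cong[OF refl], rule uniform[OF assms])
  finally have "card (lang m) * weight w = 1" by (simp add: sum_weight_lang)
  then show ?thesis by (metis nonzero_mult_div_cancel_left mult_zero_left zero_neq_one)
qed

lemma card_lang_pos: "0 < card (lang m)"
  using lang_nonempty by (simp add: card_gt_0_iff)

text \<open>The weight \<open>1 / card (lang m)\<close> of \<open>w\<close> is shared among its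
  continuations, each of weight \<open>1 / card (lang (Suc m))\<close>. Hence the number of
  continuations is the same for all \<open>w\<close>.\<close>

lemma card_lang_Suc:
  assumes w: "w \<in> lang m"
  shows "card (lang (Suc m)) = card (continuations w) * card (lang m)"
proof -
  have "1 / card (lang m) = (\<Sum>a\<in>UNIV. weight (w @ [a]))"
    using weight_uniform[OF w] weight_snoc[of w] by simp
  also have "\<dots> = (\<Sum>a\<in>continuations w. weight (w @ [a]))"
    by (rule sum.mono_neutral_right) (use weight_nonneg in \<open>auto simp: continuations_def less_le\<close>)
  also have "\<dots> = (\<Sum>a\<in>continuations w. 1 / card (lang (Suc m)))"
    using continuation_iff[OF w] by (intro sum.cong refl weight_uniform) simp
  also have "\<dots> = card (continuations w) / card (lang (Suc m))" by simp
  finally have "real (card (lang (Suc m))) = real (card (continuations w) * card (lang m))"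
    using lang_nonempty by (simp add: field_simps)
  then show ?thesis by (simp only: of_nat_eq_iff)
qed

text \<open>The division is exact by \<open>card_lang_Suc\<close>; the quotient is the common number
  of continuations.\<close>

definition ratio :: "nat \<Rightarrow> nat" where
  "ratio m = card (lang (Suc m)) div card (lang m)"

lemma card_continuations: "w \<in> lang m \<Longrightarrow> card (continuations w) = ratio m"
  using card_lang_Suc card_lang_pos[of m] by (simp add: ratio_def)

lemma card_lang_ratio: "card (lang (Suc m)) = ratio m * card (lang m)"
  using lang_nonempty[of m] card_lang_Suc card_continuations by fastforce

lemma ratio_pos: "0 < ratio m"
  using card_lang_ratio[of m] card_lang_pos[of "Suc m"] by (cases "ratio m") auto

lemma decseq_ratio: "decseq ratio"
proof (rule decseq_SucI)
  fix m
  obtain v where v: "v \<in> lang (Suc m)" using lang_nonempty by blast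
  then obtain a w where aw: "v = a # w" using length_lang[OF v] by (cases v) auto
  then have "w \<in> lang m" using v lang_tl by blast
  then show "ratio (Suc m) \<le> ratio m"
    using card_mono[OF _ continuations_Cons_subset[of a w]] v card_continuations aw
    by (metis finite)
qed

text \<open>A nonincreasing sequence of natural numbers is eventually constant. From then on
  \<open>card (lang m)\<close> grows geometrically, so its logarithm is affine in \<open>m\<close>
  with slope \<open>ln c\<close>.\<close>

lemma ln_card_lang_rate:
  obtains c M where "\<And>m. m \<ge> M \<Longrightarrow> ratio m = c"
    "(\<lambda>m. ln (card (lang m)) / m) \<longlonglongrightarrow> ln c"
proof -
  obtain M where "\<And>m. M \<le> m \<Longrightarrow> ratio m = ratio M"
  proof -
    \<comment> \<open>Once the least value is attained, monotonicity prevents the sequence from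
      leaving it.\<close>
    define c where "c = (LEAST c. c \<in> range ratio)"
    have "c \<in> range ratio" unfolding c_def by (rule LeastI[of _ "ratio 0"]) simp
    then obtain M where M: "ratio M = c" by auto
    have "c \<le> ratio m" for m unfolding c_def by (rule Least_le) simp
    then have "ratio m = ratio M" if "M \<le> m" for m
      using M decseqD[OF decseq_ratio that] by (simp add: antisym)
    then show ?thesis using that by blast
  qed note M = this
  have growth: "ln (card (lang (M + k))) = ln (card (lang M)) + k * ln (ratio M)" for k
  proof (induction k)
    case (Suc k)
    have "ln (card (lang (M + Suc k))) = ln (ratio M) + ln (card (lang (M + k)))"
      using card_lang_ratio[of "M + k"] M[of "M + k"] ratio_pos[of M] lang_nonempty[of "M + k"]
      by (simp add: ln_mult)
    then show ?case using Suc by (simp add: algebra_simps)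
  qed simp
  have "(\<lambda>m. (ln (card (lang M)) - M * ln (ratio M)) / m + ln (ratio M)) \<longlonglongrightarrow> 0 + ln (ratio M)"
    by (intro tendsto_add tendsto_const lim_const_over_n)
  moreover have "\<forall>\<^sub>F m in sequentially.
      (ln (card (lang M)) - M * ln (ratio M)) / m + ln (ratio M) = ln (card (lang m)) / m"
    \<comment> \<open>The bound \<open>M\<close> makes \<open>growth\<close> applicable, the bound 1
      keeps the denominator nonzero.\<close>
    using eventually_ge_at_top[of "max M 1"]
  proof eventually_elim
    case (elim m)
    then have "ln (card (lang m)) = ln (card (lang M)) + (real m - M) * ln (ratio M)"
      using growth[of "m - M"] by (simp add: of_nat_diff)
    then show ?case using elim by (simp add: field_simps)
  qed
  ultimately have "(\<lambda>m. ln (card (lang m)) / m) \<longlonglongrightarrow> ln (ratio M)"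
    by (simp add: tendsto_cong)
  with M show ?thesis by (rule that)
qed

text \<open>The two cases are those of the eventual ratio \<open>c\<close>: it is positive, so it
  either equals 1, which forces unique continuations at length \<open>M\<close>, or is at least
  2.\<close>

theorem periodic_or_growth:
  "(\<exists>n::nat. n \<ge> 1 \<and> (AE x in \<mu>. \<forall>i. x (i + int n) = x i)) \<or>
   (\<exists>c\<ge>2. (\<lambda>m. ln (card (lang m)) / m) \<longlonglongrightarrow> ln (real c))"
proof -
  obtain c M where cM: "\<And>m. m \<ge> M \<Longrightarrow> ratio m = c"
    "(\<lambda>m. ln (card (lang m)) / m) \<longlonglongrightarrow> ln (real c)"
    using ln_card_lang_rate by blast
  show ?thesis
  proof (cases "c = 1")
    case True
    then have "card (continuations w) = 1" if "w \<in> lang M" for w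
      using card_continuations[OF that] cM(1)[of M] by simp
    then show ?thesis using periodic_if_unique_continuations by blast
  next
    case False
    then have "c \<ge> 2" using ratio_pos[of M] cM(1)[of M] by simp
    then show ?thesis using cM(2) by blast
  qed
qed

end

section \<open>Dot-type self-joinings\<close>

text \<open>The length-\<open>m\<close> words at position 0 in the three coordinates are pairwise
  independent with common law \<open>weight\<close>, and the third is \<open>map2 f\<close> of the
  other two. So \<open>pairwise_indep_triple_uniform\<close> applies to them.\<close>

lemma (in shift_invariant) weight_uniform_if_dot_type:
  assumes "dot_type_self_joining3 \<mu> \<Lambda>" and vw: "v \<in> lang m" "w \<in> lang m"
  shows "weight v = weight w"
proof -
  let ?X = "\<lambda>(x, x', x''). x" and ?Y = "\<lambda>(x, x', x''). x'" and ?Z = "\<lambda>(x, x', x''). x''"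
  interpret J: prob_space \<Lambda>
    using assms(1) by (simp add: dot_type_self_joining3_def self_joining3_def)
  have sets_J [measurable_cong]: "sets \<Lambda> = sets (seq_space \<Otimes>\<^sub>M (seq_space \<Otimes>\<^sub>M seq_space))"
    and marg: "distr \<Lambda> seq_space ?X = \<mu>" "distr \<Lambda> seq_space ?Y = \<mu>" "distr \<Lambda> seq_space ?Z = \<mu>"
    and indep: "J.indep_var seq_space ?X seq_space ?Y" "J.indep_var seq_space ?X seq_space ?Z"
      "J.indep_var seq_space ?Y seq_space ?Z"
    using assms(1) by (auto simp: dot_type_self_joining3_def self_joining3_def triple_space_def)
  obtain f where "\<And>i. AE (x, x', x'') in \<Lambda>. x'' i = f (x i) (x' i)"
    using assms(1) by (auto simp: dot_type_self_joining3_def)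
  then have "AE t in \<Lambda>. \<forall>i. ?Z t i = f (?X t i) (?Y t i)"
    by (simp add: AE_all_countable case_prod_unfold)
  then have F: "AE t in \<Lambda>. (window 0 m \<circ> ?Z) t = map2 f ((window 0 m \<circ> ?X) t) ((window 0 m \<circ> ?Y) t)"
    by eventually_elim (auto intro!: window_map2)
  have law: "J.prob {t \<in> space \<Lambda>. (window 0 m \<circ> U) t = c} = prob {x. window 0 m x = c}"
    if U: "U \<in> \<Lambda> \<rightarrow>\<^sub>M seq_space" and d: "distr \<Lambda> seq_space U = \<mu>" for U c
  proof -
    have "prob {x. window 0 m x = c} = measure (distr \<Lambda> seq_space U) {x. window 0 m x = c}"
      by (simp add: d)
    also have "\<dots> = J.prob (U -` {x. window 0 m x = c} \<inter> space \<Lambda>)"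
      by (rule measure_distr[OF U]) (use events_window sets_eq in auto)
    also have "U -` {x. window 0 m x = c} \<inter> space \<Lambda> = {t \<in> space \<Lambda>. (window 0 m \<circ> U) t = c}"
      by auto
    finally show ?thesis ..
  qed
  have "prob {x. window 0 m x = v} = prob {x. window 0 m x = w}"
  proof (rule J.pairwise_indep_triple_uniform[where p = "\<lambda>c. prob {x. window 0 m x = c}" and F = "map2 f"
        and X = "window 0 m \<circ> ?X" and Y = "window 0 m \<circ> ?Y" and Z = "window 0 m \<circ> ?Z"])
    show "J.indep_var (count_space UNIV) (window 0 m \<circ> ?X) (count_space UNIV) (window 0 m \<circ> ?Y)"
      "J.indep_var (count_space UNIV) (window 0 m \<circ> ?X) (count_space UNIV) (window 0 m \<circ> ?Z)"
      "J.indep_var (count_space UNIV) (window 0 m \<circ> ?Y) (count_space UNIV) (window 0 m \<circ> ?Z)"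
      by (rule J.indep_var_compose[OF indep(1) measurable_window measurable_window]
          J.indep_var_compose[OF indep(2) measurable_window measurable_window]
          J.indep_var_compose[OF indep(3) measurable_window measurable_window])+
    show "finite {w :: 'a list. length w = m}"
      using finite_lists_length_eq[of "UNIV :: 'a set" m] by simp
    show "J.prob {t \<in> space \<Lambda>. (window 0 m \<circ> ?X) t = c} = prob {x. window 0 m x = c}" for c
      using J.indep_var_rv1[OF indep(1)] marg(1) by (rule law)
    show "J.prob {t \<in> space \<Lambda>. (window 0 m \<circ> ?Y) t = c} = prob {x. window 0 m x = c}" for c
      using J.indep_var_rv2[OF indep(1)] marg(2) by (rule law)
    show "J.prob {t \<in> space \<Lambda>. (window 0 m \<circ> ?Z) t = c} = prob {x. window 0 m x = c}" for c
      using J.indep_var_rv2[OF indep(2)] marg(3) by (rule law)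
    show "0 < prob {x. window 0 m x = v}" "0 < prob {x. window 0 m x = w}"
      using vw by (auto simp: lang_def weight_def)
    show "AE t in \<Lambda>. (window 0 m \<circ> ?Z) t = map2 f ((window 0 m \<circ> ?X) t) ((window 0 m \<circ> ?Y) t)"
      by (rule F)
  qed auto
  then show ?thesis using vw by (simp add: weight_def lang_def)
qed

theorem theorem3p5:
  fixes M :: "'w measure" and \<xi> :: "int \<Rightarrow> 'w \<Rightarrow> 'a::finite" and b :: real
  assumes "process M \<xi>"
    and "stationary M \<xi>"
    and "\<exists>\<Lambda>. dot_type_self_joining3 (law M \<xi>) \<Lambda>"
    and "b > 1"
  shows "periodic M \<xi> \<or> process_entropy b M \<xi> \<ge> log b 2"
proof -
  interpret P: prob_space M using assms(1) by (simp add: process_def)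
  let ?path = "\<lambda>\<omega> i. \<xi> i \<omega>"
  have path [measurable]: "?path \<in> M \<rightarrow>\<^sub>M seq_space"
    using assms(1) by (intro measurable_seqI) (simp add: process_def)
  interpret shift_invariant "law M \<xi>"
  proof (intro shift_invariant.intro shift_invariant_axioms.intro)
    show "prob_space (law M \<xi>)" unfolding law_def by (rule P.prob_space_distr[OF path])
    show "sets (law M \<xi>) = sets seq_space" by (simp add: law_def)
    show "distr (law M \<xi>) seq_space shift = law M \<xi>" using assms(2) by (simp add: stationary_def)
  qed
  obtain \<Lambda> where "dot_type_self_joining3 (law M \<xi>) \<Lambda>" using assms(3) ..
  then interpret uniform_shift_invariant "law M \<xi>"
    by unfold_locales (rule weight_uniform_if_dot_type)
  \<comment> \<open>A uniform distribution on \<open>card (lang m)\<close> words has the logarithm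
    of that number as its entropy.\<close>
  have entropy: "shannon_entropy b M (block \<xi> m) = ln (card (lang m)) / ln b" for m
  proof -
    have block: "block \<xi> m \<omega> = window 0 m (?path \<omega>)" for \<omega>
      by (simp add: block_def window_def)
    have P_block: "P.prob {\<omega> \<in> space M. block \<xi> m \<omega> = w} = weight w" if "length w = m" for w
    proof -
      have "weight w = measure (distr M seq_space ?path) {x. window 0 m x = w}"
        using that unfolding weight_def by (simp add: law_def)
      also have "\<dots> = P.prob (?path -` {x. window 0 m x = w} \<inter> space M)"
        by (rule measure_distr[OF path]) (use events_window sets_eq in auto)
      also have "?path -` {x. window 0 m x = w} \<inter> space M = {\<omega> \<in> space M. block \<xi> m \<omega> = w}"
        by (auto simp: block)
      finally show ?thesis ..
    qed
    have "lang m \<subseteq> block \<xi> m ` space M"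
    proof
      fix w assume w: "w \<in> lang m"
      then have "P.prob {\<omega> \<in> space M. block \<xi> m \<omega> = w} > 0" by (simp add: P_block lang_def)
      then have "{\<omega> \<in> space M. block \<xi> m \<omega> = w} \<noteq> {}" by (metis less_irrefl measure_empty)
      then show "w \<in> block \<xi> m ` space M" by auto
    qed
    moreover have "finite (block \<xi> m ` space M)"
      using simple_functionD(1)[OF simple_function_block[OF assms(1)]] .
    moreover have len: "length w = m" if "w \<in> block \<xi> m ` space M" for w
      using that by (auto simp: block)
    \<comment> \<open>The range of \<open>block\<close> may contain words of probability zero; the
      factor \<open>weight w\<close> makes their terms vanish.\<close>
    ultimately have "(\<Sum>w\<in>block \<xi> m ` space M. weight w * log b (weight w)) =
        (\<Sum>w\<in>lang m. weight w * log b (weight w))"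
      using weight_nonneg by (intro sum.mono_neutral_right) (auto simp: lang_def less_le)
    also have "\<dots> = (\<Sum>w\<in>lang m. 1 / card (lang m) * log b (1 / card (lang m)))"
      by (intro sum.cong refl) (simp add: weight_uniform)
    also have "\<dots> = - (ln (card (lang m)) / ln b)"
      using card_lang_pos[of m] assms(4) by (simp add: log_def ln_div)
    finally show ?thesis
      using P_block len by (simp add: shannon_entropy_block[OF assms(1,4)] cong: sum.cong)
  qed
  from periodic_or_growth show ?thesis
  proof
    assume "\<exists>n::nat. n \<ge> 1 \<and> (AE x in law M \<xi>. \<forall>i. x (i + int n) = x i)"
    then obtain n :: nat where n: "n \<ge> 1" "AE x in law M \<xi>. \<forall>i. x (i + int n) = x i" by blast
    \<comment> \<open>Almost sure periodicity under the law is pulled back along the path map to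
      \<open>M\<close>.\<close>
    from AE_distrD[OF path n(2)[unfolded law_def]] n(1) show ?thesis
      unfolding periodic_def by blast
  next
    assume "\<exists>c\<ge>2. (\<lambda>m. ln (card (lang m)) / m) \<longlonglongrightarrow> ln (real c)"
    then obtain c :: nat where c: "c \<ge> 2" "(\<lambda>m. ln (card (lang m)) / m) \<longlonglongrightarrow> ln (real c)" by blast
    have "(\<lambda>m. ln (card (lang m)) / m / ln b) \<longlonglongrightarrow> ln (real c) / ln b"
      using c(2) assms(4) by (intro tendsto_divide tendsto_const) auto
    then have "(\<lambda>m. shannon_entropy b M (block \<xi> m) / real m) \<longlonglongrightarrow> log b (real c)"
      by (simp add: entropy log_def mult.commute)
    \<comment> \<open>Convergence has just been shown, so \<open>lim\<close> denotes the genuine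
      limit.\<close>
    then have "process_entropy b M \<xi> = log b (real c)"
      unfolding process_entropy_def by (rule limI)
    then show ?thesis using c(1) assms(4) by simp
  qed
qed

end
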